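(* Let $M,N,K\ge 1$ be integers, let $P>0$ and $\sigma_k^2>0$ for $k\in\mathcal K=\{1,\dots,K\}$, and let $\mathbf g_k\in\mathbb C^{M\times 1}$ (deterministic) and $\mathbf d_k\in\mathbb C^{N\times 1}$ (random) be the satellite-side array response vectors and the user-side channel vectors described in the context, so that the channel matrix of user $k$ is $\mathbf H_k=\mathbf d_k\mathbf g_k^H$. For positive semidefinite Hermitian matrices $\mathbf Q_1,\dots,\mathbf Q_K\in\mathbb C^{M\times M}$ define the ergodic rate $$\mathcal I_k=\mathbb E\Big\{\log\det\Big(\sigma_k^2\mathbf I_N+\mathbf H_k\sum_{i=1}^K\mathbf Q_i\mathbf H_k^H\Big)\Big\}-\mathbb E\Big\{\log\det\Big(\sigma_k^2\mathbf I_N+\mathbf H_k\sum_{i\ne k}\mathbf Q_i\mathbf H_k^H\Big)\Big\}$$ $$=\mathbb E\left\{\log\left(1+\frac{\mathbf g_k^H\mathbf Q_k\mathbf g_k\|\mathbf d_k\|^2}{\sum_{i\ne k}\mathbf g_k^H\mathbf Q_i\mathbf g_k\|\mathbf d_k\|^2+\sigma_k^2}\right)\right\}.$$ Consider the optimization problem $$\mathcal P:\quad \max_{\{\mathbf Q_k\}_{k=1}^K}\ \sum_{k=1}^K\mathcal I_k\quad\text{s.t.}\quad \sum_{k=1}^K\mathrm{tr}(\mathbf Q_k)\le P,\quad \mathbf Q_k\succeq\mathbf 0\ \ \forall k\in\mathcal K.$$ Then every optimal solution $\{\mathbf Q_k\}_{k=1}^K$ of $\mathcal P$ satisfies $\mathrm{rank}(\mathbf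 Q_k)\le 1$ for all $k\in\mathcal K$.
   Context: Notation: $(\cdot)^H$ is conjugate transpose, $\|\cdot\|$ is the Euclidean norm, $\otimes$ is the Kronecker product, $\mathcal{CN}(\mathbf 0,\mathbf C)$ is the circularly symmetric complex Gaussian distribution with zero mean and covariance $\mathbf C$. Channel model. For a positive integer $n$ and antenna spacing $d>0$, with carrier wavelength $\lambda_c>0$, put $\mathbf a_n(x)=\frac1{\sqrt n}\big(1,e^{-j\frac{2\pi d}{\lambda_c}x},\dots,e^{-j\frac{2\pi d}{\lambda_c}(n-1)x}\big)^T$ (the spacing $d$ may be different along each array axis). The satellite has a uniform planar array with $M=M_{\mathrm x}M_{\mathrm y}$ elements and each user has one with $N=N_{\mathrm x'}N_{\mathrm y'}$ elements. For user $k$, with angles $(\theta_k^{\mathrm x},\theta_k^{\mathrm y})$, the satellite-side array response vector is the deterministic vector $\mathbf g_k=\mathbf a_{M_{\mathrm x}}(\sin\theta_k^{\mathrm y}\cos\theta_k^{\mathrm x})\otimes\mathbf a_{M_{\mathrm y}}(\cos\theta_k^{\mathrm y})$, which has unit norm. The user-side vector is Rician: $$\mathbf d_k=\sqrt{\tfrac{\kappa_k\beta_k}{\kappa_k+1}}\,\mathbf d_{k,0}+\sqrt{\tfrac{\beta_k}{\kappa_k+1}}\,\tilde{\mathbf d}_k,$$ where $\kappa_k\ge0$ is the Rician factor, $\beta_k=\mathbb E\{\|\mathbf d_k\|^2\}>0$ is the average channel power, $\mathbf d_{k,0}=\mathbf a_{N_{\mathrm x'}}(\sin\varphi_k^{\mathrm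 y'}\cos\varphi_k^{\mathrm x'})\otimes\mathbf a_{N_{\mathrm y'}}(\cos\varphi_k^{\mathrm y'})$ is a deterministic unit-norm array response vector (for some angles $\varphi_k^{\mathrm x'},\varphi_k^{\mathrm y'}$), and $\tilde{\mathbf d}_k\sim\mathcal{CN}(\mathbf 0,\mathbf\Sigma_k)$ with $\mathrm{tr}(\mathbf\Sigma_k)=1$. Expectations are over the $\mathbf d_k$. *)

theory Defs
  imports "HOL-Probability.Probability"
begin

subsection \<open>Complex matrices\<close>

definition ctranspose :: "complex^'n^'m \<Rightarrow> complex^'m^'n" where
  "ctranspose A = (\<chi> i j. cnj (A $ j $ i))"

definition hermitian :: "complex^'n^'n \<Rightarrow> bool" where
  "hermitian A \<longleftrightarrow> ctranspose A = A"

text \<open>The form \<open>x\<^sup>H A x\<close>; it is real when \<open>A\<close> is Hermitian.\<close>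

definition quad_form :: "complex^'n^'n \<Rightarrow> complex^'n \<Rightarrow> complex" where
  "quad_form A x = (\<Sum>i\<in>UNIV. cnj (x $ i) * (A *v x) $ i)"

definition psd :: "complex^'n^'n \<Rightarrow> bool" where
  "psd A \<longleftrightarrow> hermitian A \<and> (\<forall>x. Re (quad_form A x) \<ge> 0)"

text \<open>\<open>outer x y\<close> is \<open>x y\<^sup>H\<close>.\<close>

definition outer :: "complex^'n \<Rightarrow> complex^'m \<Rightarrow> complex^'m^'n" where
  "outer x y = (\<chi> i j. x $ i * cnj (y $ j))"

text \<open>The Kronecker product of two vectors, its entries being indexed by pairs.\<close>

definition kron :: "complex^'a \<Rightarrow> complex^'b \<Rightarrow> complex^('a \<times> 'b)" where
  "kron x y = (\<chi> p. x $ fst p * y $ snd p)"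

subsection \<open>Array response vectors\<close>

text \<open>The elements of an array axis are indexed by a finite linearly ordered type of cardinality \<open>n\<close>;
  \<open>card {..<i}\<close> is the position \<open>0, \<dots>, n - 1\<close> of the element \<open>i\<close>.\<close>

definition array_response ::
  "real \<Rightarrow> real \<Rightarrow> real \<Rightarrow> complex^'n::{finite,linorder}" where
  "array_response lam d x =
     (\<chi> i. exp (- (\<i> * of_real (2 * pi * d / lam * real (card {..<i}) * x)))
            / of_real (sqrt (real CARD('n))))"

text \<open>\<open>dx\<close>, \<open>dy\<close> are the spacings along the two axes, \<open>ax\<close>, \<open>ay\<close> the angles.\<close>

definition upa_response ::
  "real \<Rightarrow> real \<Rightarrow> real \<Rightarrow> real \<Rightarrow> real
     \<Rightarrow> complex^('a::{finite,linorder} \<times> 'b::{finite,linorder})" where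
  "upa_response lam dx dy ax ay =
     kron (array_response lam dx (sin ay * cos ax)) (array_response lam dy (cos ay))"

subsection \<open>Circularly symmetric complex Gaussian vectors\<close>

text \<open>Almost surely constant variables count as Gaussian, so that singular covariance matrices
  are allowed.\<close>

definition gaussian_variable :: "'w measure \<Rightarrow> ('w \<Rightarrow> real) \<Rightarrow> bool" where
  "gaussian_variable W X \<longleftrightarrow> X \<in> borel_measurable W \<and>
     ((\<exists>\<mu>. AE \<omega> in W. X \<omega> = \<mu>) \<or>
      (\<exists>\<mu> \<sigma>. \<sigma> > 0 \<and> distributed W lborel X (normal_density \<mu> \<sigma>)))"

text \<open>On \<open>complex^'n\<close> the real inner product \<open>w \<bullet> x\<close> is \<open>Re (w\<^sup>H x)\<close>, so these are all the
  real-linear functionals: the real and imaginary parts of the entries are jointly Gaussian.\<close>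

definition gaussian_vector :: "'w measure \<Rightarrow> ('w \<Rightarrow> complex^'n) \<Rightarrow> bool" where
  "gaussian_vector W X \<longleftrightarrow> X \<in> borel_measurable W \<and>
     (\<forall>w. gaussian_variable W (\<lambda>\<omega>. w \<bullet> X \<omega>))"

definition circularly_symmetric :: "'w measure \<Rightarrow> ('w \<Rightarrow> complex^'n) \<Rightarrow> bool" where
  "circularly_symmetric W X \<longleftrightarrow>
     (\<forall>\<theta>. distr W borel (\<lambda>\<omega>. cis \<theta> *s X \<omega>) = distr W borel X)"

definition has_CN_distribution ::
  "'w measure \<Rightarrow> ('w \<Rightarrow> complex^'n) \<Rightarrow> complex^'n^'n \<Rightarrow> bool" where
  "has_CN_distribution W X C \<longleftrightarrow>
     gaussian_vector W X \<and> circularly_symmetric W X \<and>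
     (\<integral>\<omega>. X \<omega> \<partial>W) = 0 \<and>
     (\<forall>i j. (\<integral>\<omega>. X \<omega> $ i * cnj (X \<omega> $ j) \<partial>W) = C $ i $ j)"

subsection \<open>Ergodic rate and the optimization problem\<close>

text \<open>The user-side channel with line-of-sight part \<open>d0\<close> and scattered part \<open>dt\<close>.\<close>

definition rician :: "real \<Rightarrow> real \<Rightarrow> complex^'n \<Rightarrow> complex^'n \<Rightarrow> complex^'n" where
  "rician \<kappa> \<beta> d0 dt =
     sqrt (\<kappa> * \<beta> / (\<kappa> + 1)) *\<^sub>R d0 + sqrt (\<beta> / (\<kappa> + 1)) *\<^sub>R dt"

text \<open>The users are \<open>1, \<dots>, K\<close>, \<open>s k\<close> is the noise variance of user \<open>k\<close>, and \<open>H k \<omega>\<close> its random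
  channel matrix. The determinants are those of Hermitian positive definite matrices and
  hence real.\<close>

definition ergodic_rate ::
  "'w measure \<Rightarrow> nat \<Rightarrow> (nat \<Rightarrow> real) \<Rightarrow> (nat \<Rightarrow> 'w \<Rightarrow> complex^'m^'n)
     \<Rightarrow> (nat \<Rightarrow> complex^'m^'m) \<Rightarrow> nat \<Rightarrow> real" where
  "ergodic_rate W K s H Q k =
     (\<integral>\<omega>. ln (Re (det (mat (of_real (s k))
         + H k \<omega> ** (\<Sum>i\<in>{1..K}. Q i) ** ctranspose (H k \<omega>)))) \<partial>W)
   - (\<integral>\<omega>. ln (Re (det (mat (of_real (s k))
         + H k \<omega> ** (\<Sum>i\<in>{1..K} - {k}. Q i) ** ctranspose (H k \<omega>)))) \<partial>W)"

definition feasible :: "nat \<Rightarrow> real \<Rightarrow> (nat \<Rightarrow> complex^'m^'m) \<Rightarrow> bool" where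
  "feasible K P Q \<longleftrightarrow>
     (\<Sum>k\<in>{1..K}. Re (trace (Q k))) \<le> P \<and> (\<forall>k\<in>{1..K}. psd (Q k))"

definition optimal_solution ::
  "'w measure \<Rightarrow> nat \<Rightarrow> real \<Rightarrow> (nat \<Rightarrow> real) \<Rightarrow> (nat \<Rightarrow> 'w \<Rightarrow> complex^'m^'n)
     \<Rightarrow> (nat \<Rightarrow> complex^'m^'m) \<Rightarrow> bool" where
  "optimal_solution W K P s H Q \<longleftrightarrow> feasible K P Q \<and>
     (\<forall>Q'. feasible K P Q' \<longrightarrow>
        (\<Sum>k\<in>{1..K}. ergodic_rate W K s H Q' k) \<le> (\<Sum>k\<in>{1..K}. ergodic_rate W K s H Q k))"

end

theory Submission
  imports Defs
begin

text \<open>A rank-one channel sees \<open>Q\<close> only through the numbers \<open>g\<^sub>k\<^sup>H Q\<^sub>i g\<^sub>k\<close>. Replacing \<open>Q\<^sub>j\<close> by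
  \<open>Q\<^sub>j g\<^sub>j g\<^sub>j\<^sup>H Q\<^sub>j / (g\<^sub>j\<^sup>H Q\<^sub>j g\<^sub>j)\<close>, which is of rank at most one, keeps the signal power of user
  \<open>j\<close> and, by the Cauchy-Schwarz inequality for the form \<open>Q\<^sub>j\<close>, does not increase the interference at
  the other users. It strictly lowers the trace unless it changes nothing. The saved power allows all
  matrices to be scaled up by a common factor, which strictly increases the rate of every user with a
  nonzero signal. If no user has one, then the total rate is zero and sending power to a single user is
  better.\<close>

section \<open>Determinants of rank-one perturbations of scalar matrices\<close>

text \<open>The rows \<open>axis i 1\<close> are replaced by \<open>axis i 1 + u $ i *s v\<close>
  one at a time. By multilinearity, changing row \<open>j\<close> adds \<open>u $ j\<close> times
  the determinant in which row \<open>j\<close> is \<open>v\<close>, and that determinant is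
  \<open>v $ j\<close> whatever other rows have been changed already.\<close>

lemma det_mat_1_plus_rank_one:
  fixes u v :: "'a::field^'n"
  shows "det (mat 1 + (\<chi> i j. u $ i * v $ j)) = 1 + (\<Sum>i\<in>UNIV. u $ i * v $ i)"
proof -
  let ?row = "\<lambda>S i. if i \<in> S then axis i 1 + u $ i *s v else axis i 1"
  \<comment> \<open>While row \<open>j\<close> equals \<open>v\<close>, the summand
    \<open>u $ l *s v\<close> in another row is a multiple of row \<open>j\<close>, so a row
    operation removes it. The identity with row \<open>j\<close> replaced by \<open>v\<close>
    remains, and Cramer's rule evaluates it.\<close>
  have row_v: "det (\<chi> i. if i = j then v else ?row S i) = v $ j" if "finite S" "j \<notin> S" for j S
    using that
  proof (induction S)
    case empty
    have basis: "(\<Sum>i\<in>UNIV. v $ i *s row i (mat 1 :: 'a^'n^'n)) = v"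
      by (simp add: vec_eq_iff row_def mat_def if_distrib cong: if_cong)
    have row_mat: "row i (mat 1 :: 'a^'n^'n) = axis i 1" for i
      by (auto simp: vec_eq_iff row_def mat_def axis_def)
    show ?case
      using cramer_lemma_transpose[of j v "mat 1"] unfolding basis unfolding row_mat by (simp cong: if_cong)
  next
    case (insert l S)
    let ?A = "\<chi> i. if i = j then v else ?row S i"
    have "det (\<chi> i. if i = j then v else ?row (insert l S) i)
        = det (\<chi> i. if i = l then row l ?A + u $ l *s row j ?A else row i ?A)"
      using insert by (intro arg_cong[where f = det]) (auto simp: vec_eq_iff row_def)
    also have "\<dots> = det ?A"
      using insert by (intro det_row_operation) auto
    finally show ?case
      using insert by simp
  qed
  have det_rows: "det (\<chi> i. ?row S i) = 1 + (\<Sum>i\<in>S. u $ i * v $ i)" if "finite S" for S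
    using that
  proof (induction S)
    case empty
    have "(\<chi> i. axis i 1) = (mat 1 :: 'a^'n^'n)"
      by (auto simp: vec_eq_iff mat_def axis_def)
    then show ?case by simp
  next
    case (insert j S)
    have "det (\<chi> i. ?row (insert j S) i)
        = det (\<chi> i. if i = j then axis i 1 + u $ j *s v else ?row S i)"
      by (intro arg_cong[where f = det]) (auto simp: vec_eq_iff)
    also have "\<dots> = det (\<chi> i. if i = j then axis i 1 else ?row S i)
        + det (\<chi> i. if i = j then u $ j *s v else ?row S i)"
      by (rule det_row_add)
    also have "det (\<chi> i. if i = j then u $ j *s v else ?row S i)
        = u $ j * det (\<chi> i. if i = j then v else ?row S i)"
      using det_row_mul[of j "u $ j" "\<lambda>_. v" "?row S"]
      .
    also have "(\<chi> i. if i = j then axis i 1 else ?row S i) = (\<chi> i. ?row S i)"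
      using insert by (auto simp: vec_eq_iff)
    finally show ?case
      using insert row_v[of S j] by simp
  qed
  have rows: "(\<chi> i. ?row UNIV i) = mat 1 + (\<chi> i j. u $ i * v $ j)"
    by (auto simp: vec_eq_iff mat_def axis_def)
  show ?thesis
    using det_rows[of UNIV] unfolding rows by simp
qed

lemma det_mat_plus_rank_one:
  fixes u v :: "'a::field^'n"
  assumes "s \<noteq> 0"
  shows "det (mat s + (\<chi> i j. u $ i * v $ j)) = s ^ CARD('n) * (1 + (\<Sum>i\<in>UNIV. u $ i * v $ i) / s)"
proof -
  let ?A = "mat 1 + (\<chi> i j. u $ i * ((1 / s) *s v) $ j)"
  have "mat s + (\<chi> i j. u $ i * v $ j) = (\<chi> i. s *s ?A $ i)"
    using assms by (auto simp: vec_eq_iff mat_def field_simps)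
  also have "det \<dots> = s ^ CARD('n) * det ?A"
    using det_rows_mul[of "\<lambda>_. s" "\<lambda>i. ?A $ i"] by (simp only: vec_lambda_eta prod_constant)
  finally show ?thesis
    unfolding det_mat_1_plus_rank_one by (simp add: sum_divide_distrib)
qed

section \<open>Sesquilinear forms and positive semidefinite matrices\<close>

text \<open>The polarization of \<open>quad_form\<close>: conjugate-linear in \<open>x\<close> and
  linear in \<open>y\<close>. Its off-diagonal values carry the Cauchy-Schwarz inequality.\<close>

definition sesq_form :: "complex^'n^'n \<Rightarrow> complex^'n \<Rightarrow> complex^'n \<Rightarrow> complex" where
  "sesq_form A x y = (\<Sum>i\<in>UNIV. cnj (x $ i) * (A *v y) $ i)"

lemma quad_form_eq_sesq_form: "quad_form A x = sesq_form A x x"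
  by (simp add: quad_form_def sesq_form_def)

lemma sesq_form_eq_sum:
  "sesq_form A x y = (\<Sum>i\<in>UNIV. \<Sum>j\<in>UNIV. cnj (x $ i) * A $ i $ j * y $ j)"
  by (simp add: sesq_form_def matrix_vector_mult_def sum_distrib_left mult.assoc)

lemma sesq_form_hermitian:
  assumes "hermitian A"
  shows "sesq_form A y x = cnj (sesq_form A x y)"
proof -
  have "cnj (A $ i $ j) = A $ j $ i" for i j
    using arg_cong[OF assms[unfolded hermitian_def], of "\<lambda>A. A $ j $ i"]
    by (simp add: ctranspose_def)
  then have "cnj (sesq_form A x y) = (\<Sum>i\<in>UNIV. \<Sum>j\<in>UNIV. cnj (y $ j) * A $ j $ i * x $ i)"
    by (simp add: sesq_form_eq_sum cnj_sum mult_ac)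
  also have "\<dots> = sesq_form A y x"
    unfolding sesq_form_eq_sum by (rule sum.swap)
  finally show ?thesis ..
qed

lemma sesq_form_expand:
  "sesq_form A (x + t *s y) (x + t *s y)
     = sesq_form A x x + t * sesq_form A x y + cnj t * sesq_form A y x + cnj t * t * sesq_form A y y"
  by (simp add: sesq_form_eq_sum sum.distrib sum_distrib_left algebra_simps)

lemma quad_form_add: "quad_form (A + B) x = quad_form A x + quad_form B x"
  by (simp add: quad_form_eq_sesq_form sesq_form_eq_sum sum.distrib algebra_simps)

lemma quad_form_diff: "quad_form (A - B) x = quad_form A x - quad_form B x"
  by (simp add: quad_form_eq_sesq_form sesq_form_eq_sum sum_subtractf algebra_simps)

lemma quad_form_zero [simp]: "quad_form 0 x = 0"
  by (simp add: quad_form_eq_sesq_form sesq_form_eq_sum)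

lemma quad_form_sum: "quad_form (\<Sum>i\<in>I. A i) x = (\<Sum>i\<in>I. quad_form (A i) x)"
  by (induction I rule: infinite_finite_induct) (simp_all add: quad_form_add)

lemma quad_form_scaleR: "quad_form (c *\<^sub>R A) x = c *\<^sub>R quad_form A x"
  by (simp add: quad_form_eq_sesq_form sesq_form_eq_sum scaleR_sum_right)

lemma quad_form_axis: "quad_form A (axis i 1) = A $ i $ i"
  by (simp add: quad_form_def axis_def matrix_vector_mult_def if_distrib if_distribR cong: if_cong)

lemma sesq_form_axis: "sesq_form A (axis i 1) (axis j 1) = A $ i $ j"
  by (simp add: sesq_form_def axis_def matrix_vector_mult_def if_distrib if_distribR cong: if_cong)

lemma norm_vec_power2: "(norm (x :: complex^'n))\<^sup>2 = (\<Sum>i\<in>UNIV. (cmod (x $ i))\<^sup>2)"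
  by (simp add: norm_vec_def L2_set_def sum_nonneg)

lemma quad_form_mat: "quad_form (mat c) x = c * of_real ((norm x)\<^sup>2)"
  by (simp add: quad_form_eq_sesq_form sesq_form_eq_sum mat_def norm_vec_power2 sum_distrib_left
      complex_norm_square if_distrib if_distribR mult_ac del: of_real_power cong: if_cong)

lemma psd_scaleR: "psd A \<Longrightarrow> 0 \<le> c \<Longrightarrow> psd (c *\<^sub>R A)"
  by (simp add: psd_def hermitian_def quad_form_scaleR ctranspose_def vec_eq_iff)

lemma psd_mat:
  assumes "0 \<le> c"
  shows "psd (mat (of_real c) :: complex^'n^'n)"
proof -
  have "hermitian (mat (of_real c) :: complex^'n^'n)"
    by (auto simp: hermitian_def ctranspose_def mat_def vec_eq_iff)
  with assms show ?thesis
    by (simp add: psd_def quad_form_mat flip: of_real_mult of_real_power)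
qed

lemma psd_trace_nonneg:
  assumes "psd A"
  shows "0 \<le> Re (trace A)"
proof -
  have "0 \<le> Re (A $ i $ i)" for i
    using assms quad_form_axis[of A i] by (metis psd_def)
  then show ?thesis
    by (simp add: trace_def sum_nonneg)
qed

text \<open>The form may be degenerate, so \<open>y\<close> cannot always be normalized. Instead,
  nonnegativity of the form along a real line through \<open>x\<close> gives a polynomial in
  \<open>r\<close> that is nonnegative everywhere, and a suitable \<open>r\<close> yields the
  bound.\<close>

lemma psd_cauchy_schwarz:
  assumes "psd A"
  shows "(cmod (sesq_form A x y))\<^sup>2 \<le> Re (quad_form A x) * Re (quad_form A y)"
proof -
  define b a c where "b = sesq_form A x y" and "a = Re (quad_form A x)" and "c = Re (quad_form A y)"
  have herm: "hermitian A" and nn: "Re (quad_form A z) \<ge> 0" for z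
    using assms by (auto simp: psd_def)
  have key: "0 \<le> a - 2 * r * (cmod b)\<^sup>2 + r\<^sup>2 * (cmod b)\<^sup>2 * c" for r
  proof -
    \<comment> \<open>This phase makes both cross terms real and equal to
      \<open>- r * (cmod b)^2\<close>.\<close>
    define t where "t = - (of_real r * cnj b)"
    have "t * b = of_real (- r * (cmod b)\<^sup>2)"
      unfolding t_def by (simp add: complex_norm_square mult_ac del: of_real_power)
    moreover have "cnj t * cnj b = of_real (- r * (cmod b)\<^sup>2)"
      unfolding t_def by (simp add: complex_norm_square mult_ac del: of_real_power)
    moreover have "cnj t * t = of_real (r\<^sup>2 * (cmod b)\<^sup>2)"
      using complex_norm_square[of t]
      by (simp add: t_def norm_mult power_mult_distrib mult_ac)
    ultimately have "quad_form A (x + t *s y)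
        = quad_form A x + of_real (- r * (cmod b)\<^sup>2) + of_real (- r * (cmod b)\<^sup>2)
          + of_real (r\<^sup>2 * (cmod b)\<^sup>2) * quad_form A y"
      using sesq_form_expand[of A x t y] sesq_form_hermitian[OF herm, of y x]
      by (simp only: quad_form_eq_sesq_form b_def)
    then have "Re (quad_form A (x + t *s y)) = a - 2 * r * (cmod b)\<^sup>2 + r\<^sup>2 * (cmod b)\<^sup>2 * c"
      by (simp add: a_def c_def flip: of_real_power of_real_mult)
    then show ?thesis
      using nn by metis
  qed
  have "0 \<le> a" "0 \<le> c"
    using nn by (auto simp: a_def c_def)
  have "(cmod b)\<^sup>2 \<le> a * c"
  proof (cases "c = 0")
    case True
    have "b = 0"
    proof (rule ccontr)
      assume "b \<noteq> 0"
      \<comment> \<open>For \<open>c = 0\<close> the polynomial is linear in \<open>r\<close>; this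
        value of \<open>r\<close> brings it down to -1.\<close>
      then have "2 * ((a + 1) / (2 * (cmod b)\<^sup>2)) * (cmod b)\<^sup>2 = a + 1"
        by simp
      with key[of "(a + 1) / (2 * (cmod b)\<^sup>2)"] True show False
        by simp
    qed
    then show ?thesis using True by simp
  next
    case False
    \<comment> \<open>The quadratic polynomial has its minimum at \<open>r = 1 / c\<close>.\<close>
    have eq: "a - 2 * (1 / c) * (cmod b)\<^sup>2 + (1 / c)\<^sup>2 * (cmod b)\<^sup>2 * c = a - (cmod b)\<^sup>2 / c"
      using False by (simp add: power2_eq_square)
    show ?thesis
      using key[of "1 / c"] \<open>0 \<le> c\<close> False unfolding eq by (simp add: field_simps)
  qed
  then show ?thesis by (simp add: a_def b_def c_def)
qed

text \<open>The diagonal entries are nonnegative with sum zero, hence all zero, and Cauchy-Schwarz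
  at basis vectors bounds every other entry by diagonal ones.\<close>

lemma psd_trace_zero:
  assumes "psd A" "Re (trace A) = 0"
  shows "A = 0"
proof -
  have nn: "0 \<le> Re (A $ i $ i)" for i
    using assms quad_form_axis[of A i] by (metis psd_def)
  then have diag: "Re (A $ i $ i) = 0" for i
    using assms(2) by (simp add: trace_def sum_nonneg_eq_0_iff)
  have "A $ i $ j = 0" for i j
    using psd_cauchy_schwarz[OF assms(1), of "axis i 1" "axis j 1"] diag
    by (simp add: sesq_form_axis quad_form_axis)
  then show ?thesis by (simp add: vec_eq_iff)
qed

section \<open>The rank-one replacement of a covariance matrix\<close>

text \<open>If \<open>x\<^sup>H A x = 0\<close>, then \<open>A x = 0\<close> for psd \<open>A\<close>, and the junk value of the division makes
  \<open>beam A x = 0\<close>, as it should be.\<close>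

definition beam :: "complex^'n^'n \<Rightarrow> complex^'n \<Rightarrow> complex^'n^'n" where
  "beam A x = (1 / Re (quad_form A x)) *\<^sub>R outer (A *v x) (A *v x)"

lemma quad_form_beam:
  "quad_form (beam A x) y = of_real ((cmod (sesq_form A y x))\<^sup>2 / Re (quad_form A x))"
proof -
  have "quad_form (outer v v) y = (\<Sum>i\<in>UNIV. cnj (y $ i) * v $ i) * cnj (\<Sum>i\<in>UNIV. cnj (y $ i) * v $ i)"
    for v
    by (simp add: quad_form_eq_sesq_form sesq_form_eq_sum outer_def sum_product cnj_sum mult_ac)
  from this[of "A *v x"] have "quad_form (outer (A *v x) (A *v x)) y = of_real ((cmod (sesq_form A y x))\<^sup>2)"
    by (simp only: sesq_form_def[symmetric] complex_norm_square)
  then show ?thesis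
    unfolding beam_def quad_form_scaleR by (simp add: scaleR_conv_of_real del: of_real_power)
qed

lemma quad_form_beam_self:
  assumes "psd A"
  shows "Re (quad_form (beam A x) x) = Re (quad_form A x)"
proof -
  have "sesq_form A x x = cnj (sesq_form A x x)"
    using assms by (intro sesq_form_hermitian) (simp add: psd_def)
  then have "Im (sesq_form A x x) = 0"
    by (simp add: complex_eq_iff)
  then have "cmod (sesq_form A x x) = \<bar>Re (quad_form A x)\<bar>"
    by (simp add: cmod_eq_Re quad_form_eq_sesq_form)
  then show ?thesis
    by (simp add: quad_form_beam power2_eq_square)
qed

text \<open>Cauchy-Schwarz divided by the value at \<open>x\<close>. If that value is zero, division
  by zero makes the left side 0.\<close>

lemma quad_form_beam_le:
  assumes "psd A"
  shows "Re (quad_form (beam A x) y) \<le> Re (quad_form A y)"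
proof -
  have nn: "0 \<le> Re (quad_form A z)" for z
    using assms by (simp add: psd_def)
  show ?thesis
    using psd_cauchy_schwarz[OF assms, of y x] nn[of x] nn[of y]
    by (cases "Re (quad_form A x) = 0") (simp_all add: quad_form_beam field_simps)
qed

lemma hermitian_beam: "hermitian (beam A x)"
  by (simp add: hermitian_def ctranspose_def beam_def outer_def vec_eq_iff mult.commute)

lemma psd_beam:
  assumes "psd A"
  shows "psd (beam A x)"
  using assms by (simp add: psd_def hermitian_beam quad_form_beam)

text \<open>By \<open>quad_form_beam_le\<close> the difference \<open>A - beam A x\<close> is psd,
  so its trace is nonnegative and vanishes only if the difference does.\<close>

lemma trace_beam_less:
  assumes "psd A" "beam A x \<noteq> A"
  shows "Re (trace (beam A x)) < Re (trace A)"
proof -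
  have "psd (A - beam A x)"
    using quad_form_beam_le[OF assms(1)] hermitian_beam[of A x] assms(1)
    by (simp add: psd_def hermitian_def quad_form_diff ctranspose_def vec_eq_iff)
  moreover have "trace (A - beam A x) = trace A - trace (beam A x)"
    by (simp add: trace_def sum_subtractf)
  ultimately show ?thesis
    using psd_trace_nonneg[of "A - beam A x"] psd_trace_zero[of "A - beam A x"] assms(2) by force
qed

text \<open>All rows are multiples of the conjugate of \<open>A *v x\<close>.\<close>

lemma rank_beam: "rank (beam A x) \<le> 1"
proof -
  define w where "w = (\<chi> j. cnj ((A *v x) $ j))"
  have row: "row i (beam A x) = ((1 / Re (quad_form A x)) *\<^sub>R (A *v x) $ i) *s w" for i
    by (simp add: beam_def row_def outer_def w_def vec_eq_iff)
  then have "rows (beam A x) \<subseteq> vec.span {w}"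
    unfolding rows_def row by (blast intro: vec.span_scale vec.span_base)
  then have "vec.dim (rows (beam A x)) \<le> card {w}"
    by (intro vec.dim_le_card) auto
  then show ?thesis
    by (simp add: row_rank_def_gen)
qed

section \<open>Integrability and nondegeneracy of the Rician channel gain\<close>

lemma (in prob_space) gaussian_variable_square_integrable:
  assumes "gaussian_variable M X"
  shows "integrable M (\<lambda>\<omega>. (X \<omega>)\<^sup>2)"
proof -
  have meas [measurable]: "X \<in> borel_measurable M"
    using assms by (simp add: gaussian_variable_def)
  from assms consider (const) \<mu> where "AE \<omega> in M. X \<omega> = \<mu>"
    | (normal) \<mu> \<sigma> where "\<sigma> > 0" "distributed M lborel X (normal_density \<mu> \<sigma>)"
    by (auto simp: gaussian_variable_def)
  then show ?thesis
  proof cases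
    case const
    then have "integrable M (\<lambda>\<omega>. (X \<omega>)\<^sup>2) \<longleftrightarrow> integrable M (\<lambda>\<omega>. \<mu>\<^sup>2)"
      by (intro integrable_cong_AE) auto
    then show ?thesis by simp
  next
    case normal
    have moment: "integrable M (\<lambda>\<omega>. (X \<omega> - \<mu>) ^ k)" for k
      using distributed_integrable[OF normal(2), of "\<lambda>x. (x - \<mu>) ^ k"]
        integrable_normal_moment[OF normal(1), of \<mu> k]
      by simp
    \<comment> \<open>The square is expanded about the mean, since integrability is known for the
      central moments.\<close>
    have "integrable M (\<lambda>\<omega>. (X \<omega> - \<mu>) ^ 2 + 2 * \<mu> * (X \<omega> - \<mu>) ^ 1 + \<mu>\<^sup>2)"
      using moment[of 1] moment[of 2] by simp
    moreover have "(X \<omega> - \<mu>) ^ 2 + 2 * \<mu> * (X \<omega> - \<mu>) ^ 1 + \<mu>\<^sup>2 = (X \<omega>)\<^sup>2" for \<omega>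
      by (simp add: power2_eq_square algebra_simps)
    ultimately show ?thesis by simp
  qed
qed

text \<open>Over the real Euclidean basis the squared norm is a finite sum of squares of Gaussian
  coordinates.\<close>

lemma (in prob_space) gaussian_vector_norm_square_integrable:
  assumes "gaussian_vector M X"
  shows "integrable M (\<lambda>\<omega>. (norm (X \<omega>))\<^sup>2)"
proof -
  have "(norm (X \<omega>))\<^sup>2 = (\<Sum>b\<in>Basis. (b \<bullet> X \<omega>)\<^sup>2)" for \<omega>
    unfolding power2_norm_eq_inner
    by (subst euclidean_inner) (simp add: power2_eq_square inner_commute)
  moreover have "integrable M (\<lambda>\<omega>. (b \<bullet> X \<omega>)\<^sup>2)" for b
    using assms by (intro gaussian_variable_square_integrable) (simp add: gaussian_vector_def)
  ultimately show ?thesis by simp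
qed

lemma norm_add_power2_le:
  fixes x y :: "'a::real_normed_vector"
  shows "(norm (x + y))\<^sup>2 \<le> 2 * (norm x)\<^sup>2 + 2 * (norm y)\<^sup>2"
proof -
  have "(norm (x + y))\<^sup>2 \<le> (norm x + norm y)\<^sup>2"
    by (intro power_mono norm_triangle_ineq norm_ge_zero)
  also have "\<dots> \<le> 2 * (norm x)\<^sup>2 + 2 * (norm y)\<^sup>2"
    using sum_squares_bound[of "norm x" "norm y"] by (simp add: power2_sum)
  finally show ?thesis .
qed

lemma (in prob_space) rician_norm_square_integrable:
  assumes "gaussian_vector M X"
  shows "integrable M (\<lambda>\<omega>. (norm (rician \<kappa> \<beta> d0 (X \<omega>)))\<^sup>2)"
proof -
  let ?a = "sqrt (\<kappa> * \<beta> / (\<kappa> + 1))" and ?b = "sqrt (\<beta> / (\<kappa> + 1))"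
  have [measurable]: "X \<in> borel_measurable M"
    using assms by (simp add: gaussian_vector_def)
  have "integrable M (\<lambda>\<omega>. 2 * (norm (?a *\<^sub>R d0))\<^sup>2 + 2 * ?b\<^sup>2 * (norm (X \<omega>))\<^sup>2)"
    using gaussian_vector_norm_square_integrable[OF assms] by simp
  then show ?thesis
  proof (rule Bochner_Integration.integrable_bound)
    show "(\<lambda>\<omega>. (norm (rician \<kappa> \<beta> d0 (X \<omega>)))\<^sup>2) \<in> borel_measurable M"
      unfolding rician_def by measurable
    show "AE \<omega> in M. norm ((norm (rician \<kappa> \<beta> d0 (X \<omega>)))\<^sup>2)
        \<le> norm (2 * (norm (?a *\<^sub>R d0))\<^sup>2 + 2 * ?b\<^sup>2 * (norm (X \<omega>))\<^sup>2)"
      using norm_add_power2_le[of "?a *\<^sub>R d0" "?b *\<^sub>R X \<omega>" for \<omega>]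
      by (intro AE_I2) (simp add: rician_def power_mult_distrib mult.assoc del: real_sqrt_pow2_iff)
  qed
qed

text \<open>A channel that vanishes almost surely would make the scattered part almost surely
  constant. Its zero mean makes that constant 0, so the covariance is 0, against trace 1. Strict
  rate gains rest on this, since a dead channel has rate 0 whatever is sent.\<close>

lemma (in prob_space) rician_not_AE_zero:
  fixes X :: "'a \<Rightarrow> complex^'n"
  assumes CN: "has_CN_distribution M X C" and tr: "trace C = 1" and "0 \<le> \<kappa>" "0 < \<beta>"
  shows "\<not> (AE \<omega> in M. rician \<kappa> \<beta> d0 (X \<omega>) = 0)"
proof
  let ?a = "sqrt (\<kappa> * \<beta> / (\<kappa> + 1))" and ?b = "sqrt (\<beta> / (\<kappa> + 1))"
  assume zero: "AE \<omega> in M. rician \<kappa> \<beta> d0 (X \<omega>) = 0"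
  have [measurable]: "X \<in> borel_measurable M"
    using CN by (simp add: has_CN_distribution_def gaussian_vector_def)
  have b: "?b \<noteq> 0"
    using assms by simp
  define c where "c = - ((?a / ?b) *\<^sub>R d0)"
  have solve: "x = - ((p / q) *\<^sub>R y)" if "p *\<^sub>R y + q *\<^sub>R x = 0" "q \<noteq> 0"
    for p q and x y :: "complex^'n"
  proof -
    have "q *\<^sub>R x = q *\<^sub>R - ((p / q) *\<^sub>R y)"
      using that by (simp add: add_eq_0_iff)
    with that(2) show ?thesis
      by (simp only: scaleR_cancel_left simp_thms)
  qed
  have X_c: "AE \<omega> in M. X \<omega> = c"
    using zero
  proof eventually_elim
    case (elim \<omega>)
    then show ?case
      unfolding c_def rician_def by (rule solve[OF _ b])
  qed
  have "(\<integral>\<omega>. X \<omega> \<partial>M) = (\<integral>\<omega>. c \<partial>M)"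
    using X_c by (intro integral_cong_AE) auto
  then have "c = 0"
    using CN by (simp add: has_CN_distribution_def prob_space)
  with X_c have "AE \<omega> in M. X \<omega> $ i * cnj (X \<omega> $ j) = 0" for i j
    by auto
  then have "C $ i $ j = 0" for i j
    using CN integral_eq_zero_AE unfolding has_CN_distribution_def by metis
  with tr show False
    by (simp add: trace_def)
qed

section \<open>Mean rate as a function of signal and interference power\<close>

text \<open>\<open>a\<close> is the signal power and \<open>b\<close> the interference power before
  the common random gain \<open>X\<close>; \<open>s\<close> is the noise power.\<close>

definition mean_rate :: "'w measure \<Rightarrow> ('w \<Rightarrow> real) \<Rightarrow> real \<Rightarrow> real \<Rightarrow> real \<Rightarrow> real" where
  "mean_rate M X s a b = (\<integral>\<omega>. ln (1 + a * X \<omega> / (b * X \<omega> + s)) \<partial>M)"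

text \<open>The logarithm is nonnegative and, by \<open>ln (1 + t) <= t\<close>, at most the ratio
  without interference, which is linear in \<open>X\<close>.\<close>

lemma integrable_log_one_plus_sinr:
  fixes X :: "'w \<Rightarrow> real"
  assumes X: "integrable M X" "\<And>\<omega>. 0 \<le> X \<omega>" and "0 < s" "0 \<le> a" "0 \<le> b"
  shows "integrable M (\<lambda>\<omega>. ln (1 + a * X \<omega> / (b * X \<omega> + s)))"
proof (rule Bochner_Integration.integrable_bound)
  show "integrable M (\<lambda>\<omega>. a / s * X \<omega>)"
    using X(1) by (rule integrable_mult_right)
  have [measurable]: "X \<in> borel_measurable M"
    using X(1) by (rule borel_measurable_integrable)
  show "(\<lambda>\<omega>. ln (1 + a * X \<omega> / (b * X \<omega> + s))) \<in> borel_measurable M"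
    by measurable
  have "norm (ln (1 + a * x / (b * x + s))) \<le> norm (a / s * x)" if "0 \<le> x" for x
  proof -
    have nn: "0 \<le> a * x / (b * x + s)"
      using assms that by simp
    then have "norm (ln (1 + a * x / (b * x + s))) = ln (1 + a * x / (b * x + s))"
      by simp
    also have "\<dots> \<le> a * x / (b * x + s)"
      using nn by (rule ln_add_one_self_le_self)
    also have "\<dots> \<le> a * x / s"
      using assms that by (intro divide_left_mono) (simp_all add: add_nonneg_pos)
    also have "\<dots> = a / s * x"
      by simp
    also have "\<dots> \<le> norm (a / s * x)"
      unfolding real_norm_def by (rule abs_ge_self)
    finally show ?thesis .
  qed
  then show "AE \<omega> in M. norm (ln (1 + a * X \<omega> / (b * X \<omega> + s))) \<le> norm (a / s * X \<omega>)"
    using X(2) by simp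
qed

text \<open>After cross-multiplication the two ratios compare term by term. The hypothesis
  \<open>a * b' <= a' * b\<close> says that the signal-to-interference ratio does not drop. It
  covers both moves needed later: less interference at equal signal, and a common scaling of signal
  and interference.\<close>

lemma log_one_plus_sinr_mono:
  fixes x :: real
  assumes "0 \<le> x" "0 < s" "0 \<le> a" "0 \<le> b" "0 \<le> b'" "a \<le> a'" "a * b' \<le> a' * b"
  shows "ln (1 + a * x / (b * x + s)) \<le> ln (1 + a' * x / (b' * x + s))"
    and "0 < x \<Longrightarrow> a < a' \<Longrightarrow> ln (1 + a * x / (b * x + s)) < ln (1 + a' * x / (b' * x + s))"
proof -
  have pos: "0 < b * x + s" "0 < b' * x + s"
    using assms by (simp_all add: add_nonneg_pos)
  have nn: "0 \<le> a * x / (b * x + s)" "0 \<le> a' * x / (b' * x + s)"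
    using assms pos by simp_all
  have le: "a * b' * x + a * s \<le> a' * b * x + a' * s"
    using assms by (intro add_mono mult_right_mono) simp_all
  have "a * x * (b' * x + s) \<le> a' * x * (b * x + s)"
    using mult_left_mono[OF le assms(1)] by (simp add: algebra_simps)
  then have "a * x / (b * x + s) \<le> a' * x / (b' * x + s)"
    using pos by (simp add: divide_le_eq le_divide_eq mult_ac)
  then show "ln (1 + a * x / (b * x + s)) \<le> ln (1 + a' * x / (b' * x + s))"
    using nn by simp
  assume strict: "0 < x" "a < a'"
  have less: "a * b' * x + a * s < a' * b * x + a' * s"
    using assms strict by (intro add_le_less_mono mult_right_mono mult_strict_right_mono) simp_all
  have "a * x * (b' * x + s) < a' * x * (b * x + s)"
    using mult_strict_left_mono[OF less strict(1)] by (simp add: algebra_simps)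
  then have "a * x / (b * x + s) < a' * x / (b' * x + s)"
    using pos by (simp add: divide_less_eq less_divide_eq mult_ac)
  then show "ln (1 + a * x / (b * x + s)) < ln (1 + a' * x / (b' * x + s))"
    using nn by simp
qed

lemma mean_rate_mono:
  fixes X :: "'w \<Rightarrow> real"
  assumes X: "integrable M X" "\<And>\<omega>. 0 \<le> X \<omega>"
    and "0 < s" "0 \<le> a" "0 \<le> b" "0 \<le> b'" "a \<le> a'" "a * b' \<le> a' * b"
  shows "mean_rate M X s a b \<le> mean_rate M X s a' b'"
  unfolding mean_rate_def using assms
  by (intro integral_mono integrable_log_one_plus_sinr log_one_plus_sinr_mono(1)) simp_all

text \<open>The integrands differ strictly wherever \<open>X\<close> is positive, so equal integrals
  would force \<open>X\<close> to vanish almost everywhere.\<close>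

lemma mean_rate_strict_mono:
  fixes X :: "'w \<Rightarrow> real"
  assumes X: "integrable M X" "\<And>\<omega>. 0 \<le> X \<omega>" "\<not> (AE \<omega> in M. X \<omega> = 0)"
    and s: "0 < s" "0 \<le> a" "0 \<le> b" "0 \<le> b'" "a < a'" "a * b' \<le> a' * b"
  shows "mean_rate M X s a b < mean_rate M X s a' b'"
proof (rule ccontr)
  let ?f = "\<lambda>\<omega>. ln (1 + a * X \<omega> / (b * X \<omega> + s))"
    and ?g = "\<lambda>\<omega>. ln (1 + a' * X \<omega> / (b' * X \<omega> + s))"
  have int: "integrable M ?f" "integrable M ?g"
    using assms by (auto intro!: integrable_log_one_plus_sinr)
  have le: "?f \<omega> \<le> ?g \<omega>" for \<omega>
    using assms by (intro log_one_plus_sinr_mono) simp_all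
  assume "\<not> mean_rate M X s a b < mean_rate M X s a' b'"
  with mean_rate_mono[of M X s a b b' a'] assms have "(\<integral>\<omega>. ?g \<omega> - ?f \<omega> \<partial>M) = 0"
    using int by (simp add: mean_rate_def)
  with int le have "AE \<omega> in M. ?g \<omega> - ?f \<omega> = 0"
    by (subst (asm) integral_nonneg_eq_0_iff_AE) auto
  then have "AE \<omega> in M. X \<omega> = 0"
  proof eventually_elim
    case (elim \<omega>)
    then show ?case
      using log_one_plus_sinr_mono(2)[of "X \<omega>" s a b b' a'] s X(2)[of \<omega>] by fastforce
  qed
  with X(3) show False ..
qed

lemma mean_rate_0 [simp]: "mean_rate M X s 0 b = 0"
  by (simp add: mean_rate_def)

section \<open>The ergodic rate of a rank-one channel\<close>

text \<open>With \<open>q = quad_form S g\<close>, the product of the three matrices is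
  \<open>q\<close> times \<open>outer d d\<close>, a rank-one perturbation of the noise
  term.\<close>

lemma det_rank_one_channel:
  fixes d :: "complex^'n" and g :: "complex^'m"
  assumes "0 < s"
  shows "Re (det (mat (of_real s) + outer d g ** S ** ctranspose (outer d g)))
    = s ^ CARD('n) * (1 + Re (quad_form S g) * (norm d)\<^sup>2 / s)"
proof -
  let ?q = "quad_form S g"
  have "(outer d g ** S ** ctranspose (outer d g)) $ i $ j = (?q *s d) $ i * (\<chi> j. cnj (d $ j)) $ j" for i j
    unfolding quad_form_eq_sesq_form sesq_form_eq_sum
    by (subst sum.swap) (simp add: matrix_matrix_mult_def outer_def ctranspose_def
        sum_distrib_left sum_distrib_right mult_ac)
  then have "outer d g ** S ** ctranspose (outer d g) = (\<chi> i j. (?q *s d) $ i * (\<chi> j. cnj (d $ j)) $ j)"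
    by (simp add: vec_eq_iff)
  moreover have "(\<Sum>i\<in>UNIV. (?q *s d) $ i * (\<chi> j. cnj (d $ j)) $ i) = ?q * of_real ((norm d)\<^sup>2)"
    by (simp add: norm_vec_power2 sum_distrib_left complex_norm_square mult.assoc del: of_real_power)
  ultimately have "det (mat (of_real s) + outer d g ** S ** ctranspose (outer d g))
      = of_real (s ^ CARD('n)) * (1 + ?q * of_real ((norm d)\<^sup>2) / of_real s)"
    using det_mat_plus_rank_one[of "of_real s" "?q *s d" "\<chi> j. cnj (d $ j)"] assms by simp
  then show ?thesis
    by (simp flip: of_real_mult of_real_power of_real_divide times_divide_eq_right)
qed

text \<open>The powers of \<open>s k\<close> cancel in the difference of the log-determinants, and
  the remaining quotient is one plus the signal-to-interference-plus-noise ratio. Both expectations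
  must be finite before they can be merged into one integral.\<close>

lemma (in prob_space) ergodic_rate_rank_one:
  fixes d :: "'a \<Rightarrow> complex^'n" and g :: "complex^'m"
  assumes X: "integrable M (\<lambda>\<omega>. (norm (d \<omega>))\<^sup>2)" and s: "0 < s k" and k: "k \<in> {1..K}"
    and psd: "\<And>i. i \<in> {1..K} \<Longrightarrow> psd (Q i)"
    and H: "\<And>\<omega>. H k \<omega> = outer (d \<omega>) g"
  shows "ergodic_rate M K s H Q k
    = mean_rate M (\<lambda>\<omega>. (norm (d \<omega>))\<^sup>2) (s k) (Re (quad_form (Q k) g))
        (\<Sum>i\<in>{1..K} - {k}. Re (quad_form (Q i) g))"
proof -
  define a b where "a = Re (quad_form (Q k) g)" and "b = (\<Sum>i\<in>{1..K} - {k}. Re (quad_form (Q i) g))"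
  have nn: "0 \<le> a" "0 \<le> b"
    using psd k by (auto simp: a_def b_def psd_def intro!: sum_nonneg)
  let ?n = "CARD('n)"
  let ?l = "\<lambda>c x. ln (s k ^ ?n * (1 + c * x / s k))"
  have pos: "0 < 1 + c * x / s k" if "0 \<le> c" "0 \<le> x" for c x
    using s that by (simp add: add_pos_nonneg)
  \<comment> \<open>The term \<open>0 * x\<close> gives the logarithm the shape of the
    interference-free case of \<open>integrable_log_one_plus_sinr\<close>.\<close>
  have l: "?l c x = ln (s k ^ ?n) + ln (1 + c * x / (0 * x + s k))" if "0 \<le> c" "0 \<le> x" for c x
    using s pos[OF that] by (simp add: ln_mult)
  have int: "integrable M (\<lambda>\<omega>. ?l c ((norm (d \<omega>))\<^sup>2))" if "0 \<le> c" for c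
    using integrable_log_one_plus_sinr[OF X _ s that, of 0] that
    by (subst l) simp_all
  have "?l (a + b) x - ?l b x = ln (1 + a * x / (b * x + s k))" if "0 \<le> x" for x
  proof -
    have pos: "0 < 1 + b * x / s k" "0 < 1 + (a + b) * x / s k" "0 < b * x + s k"
      using s nn that by (simp_all add: add_pos_nonneg add_nonneg_pos)
    have "?l (a + b) x - ?l b x = ln ((1 + (a + b) * x / s k) / (1 + b * x / s k))"
      using s pos by (simp add: ln_mult ln_div)
    also have "(1 + (a + b) * x / s k) / (1 + b * x / s k) = 1 + a * x / (b * x + s k)"
    proof -
      have "1 + (a + b) * x / s k = (b * x + s k + a * x) / s k"
        "1 + b * x / s k = (b * x + s k) / s k"
        using s by (simp_all add: field_simps)
      then have "(1 + (a + b) * x / s k) / (1 + b * x / s k) = (b * x + s k + a * x) / (b * x + s k)"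
        using s by simp
      also have "\<dots> = 1 + a * x / (b * x + s k)"
        using pos(3) by (simp add: field_simps)
      finally show ?thesis .
    qed
    finally show ?thesis .
  qed
  then have "mean_rate M (\<lambda>\<omega>. (norm (d \<omega>))\<^sup>2) (s k) a b
      = (\<integral>\<omega>. ?l (a + b) ((norm (d \<omega>))\<^sup>2) - ?l b ((norm (d \<omega>))\<^sup>2) \<partial>M)"
    by (simp add: mean_rate_def)
  also have "\<dots> = (\<integral>\<omega>. ?l (a + b) ((norm (d \<omega>))\<^sup>2) \<partial>M) - (\<integral>\<omega>. ?l b ((norm (d \<omega>))\<^sup>2) \<partial>M)"
    using nn by (intro Bochner_Integration.integral_diff int) simp_all
  also have "a + b = Re (quad_form (\<Sum>i\<in>{1..K}. Q i) g)"
    using k by (simp add: a_def b_def quad_form_add quad_form_sum sum.remove)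
  also have "b = Re (quad_form (\<Sum>i\<in>{1..K} - {k}. Q i) g)"
    by (simp add: b_def quad_form_sum)
  finally show ?thesis
    unfolding ergodic_rate_def H det_rank_one_channel[OF s] a_def b_def by (simp add: quad_form_sum)
qed

section \<open>Improving a solution that differs from its rank-one replacement\<close>

lemma trace_scaleR: "trace (c *\<^sub>R A :: complex^'n^'n) = c *\<^sub>R trace A"
  by (simp add: trace_def scaleR_sum_right)

text \<open>The channel model enters only through the rate formula and the properties of the gains
  \<open>X k\<close>. The conclusion is an equality because its negation is exactly what makes the
  trace drop strictly; the rank bound then follows from \<open>rank_beam\<close>.\<close>

lemma optimal_solution_eq_beam:
  fixes g :: "nat \<Rightarrow> complex^'m" and X :: "nat \<Rightarrow> 'w \<Rightarrow> real"
  assumes P: "0 < P" and "1 \<le> K" and g: "g 1 \<noteq> 0"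
    and s: "\<And>k. k \<in> {1..K} \<Longrightarrow> 0 < s k"
    and X: "\<And>k. k \<in> {1..K} \<Longrightarrow> integrable M (X k)" "\<And>k \<omega>. 0 \<le> X k \<omega>"
      "\<And>k. k \<in> {1..K} \<Longrightarrow> \<not> (AE \<omega> in M. X k \<omega> = 0)"
    and rate: "\<And>Q k. (\<And>i. i \<in> {1..K} \<Longrightarrow> psd (Q i)) \<Longrightarrow> k \<in> {1..K} \<Longrightarrow>
      ergodic_rate M K s H Q k = mean_rate M (X k) (s k) (Re (quad_form (Q k) (g k)))
        (\<Sum>i\<in>{1..K} - {k}. Re (quad_form (Q i) (g k)))"
    and opt: "optimal_solution M K P s H Q" and j: "j \<in> {1..K}"
  shows "beam (Q j) (g j) = Q j"
proof (rule ccontr)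
  assume neq: "beam (Q j) (g j) \<noteq> Q j"
  let ?I = "{1..K}"
  define R where "R Q k = mean_rate M (X k) (s k) (Re (quad_form (Q k) (g k)))
    (\<Sum>i\<in>?I - {k}. Re (quad_form (Q i) (g k)))" for Q k
  have psd: "psd (Q i)" if "i \<in> ?I" for i
    using opt that by (simp add: optimal_solution_def feasible_def)
  have best: "(\<Sum>k\<in>?I. R Q' k) \<le> (\<Sum>k\<in>?I. R Q k)" if "feasible K P Q'" for Q'
  proof -
    have "(\<Sum>k\<in>?I. ergodic_rate M K s H Q' k) \<le> (\<Sum>k\<in>?I. ergodic_rate M K s H Q k)"
      using opt that by (simp add: optimal_solution_def)
    moreover have "(\<Sum>k\<in>?I. ergodic_rate M K s H Q' k) = (\<Sum>k\<in>?I. R Q' k)"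
      using that unfolding feasible_def R_def by (intro sum.cong refl rate) auto
    moreover have "(\<Sum>k\<in>?I. ergodic_rate M K s H Q k) = (\<Sum>k\<in>?I. R Q k)"
      using psd unfolding R_def by (intro sum.cong refl rate) auto
    ultimately show ?thesis by simp
  qed
  define Q1 where "Q1 = Q(j := beam (Q j) (g j))"
  have psd1: "psd (Q1 i)" if "i \<in> ?I" for i
    using psd that by (simp add: Q1_def psd_beam)
  have nn: "0 \<le> Re (quad_form (Q i) x)" "0 \<le> Re (quad_form (Q1 i) x)" if "i \<in> ?I" for i x
    using psd[OF that] psd1[OF that] by (simp_all add: psd_def)
  have signal: "Re (quad_form (Q1 k) (g k)) = Re (quad_form (Q k) (g k))" if "k \<in> ?I" for k
    using quad_form_beam_self[OF psd[OF that]] by (auto simp: Q1_def)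
  have interference: "(\<Sum>i\<in>?I - {k}. Re (quad_form (Q1 i) x)) \<le> (\<Sum>i\<in>?I - {k}. Re (quad_form (Q i) x))"
    for k x
    using psd by (intro sum_mono) (simp add: Q1_def quad_form_beam_le)
  \<comment> \<open>At equal signal, the ratio condition of \<open>mean_rate_mono\<close> is the
    interference bound multiplied by the signal power.\<close>
  have R_Q1: "R Q k \<le> R Q1 k" if "k \<in> ?I" for k
    unfolding R_def signal[OF that] using that s X nn interference
    by (intro mean_rate_mono mult_left_mono sum_nonneg) auto
  define T where "T = (\<Sum>k\<in>?I. Re (trace (Q1 k)))"
  have "T < (\<Sum>k\<in>?I. Re (trace (Q k)))"
    unfolding T_def
  proof (rule sum_strict_mono_ex1)
    show "\<forall>k\<in>?I. Re (trace (Q1 k)) \<le> Re (trace (Q k))"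
      using trace_beam_less[OF psd[OF j] neq] by (auto simp: Q1_def)
    show "\<exists>k\<in>?I. Re (trace (Q1 k)) < Re (trace (Q k))"
      using trace_beam_less[OF psd[OF j] neq] j by (auto simp: Q1_def)
  qed simp
  also have "\<dots> \<le> P"
    using opt by (simp add: optimal_solution_def feasible_def)
  finally have "T < P" .
  \<comment> \<open>If \<open>T\<close> is positive, \<open>P / T\<close> exceeds 1 and uses up the
    whole budget; otherwise any factor above 1 will do.\<close>
  then obtain c where c: "1 < c" "c * T \<le> P"
    using that[of 2] that[of "P / T"] P by (cases "T \<le> 0") auto
  have R_scale: "R Q1 k \<le> R (\<lambda>i. c *\<^sub>R Q1 i) k"
    "0 < Re (quad_form (Q1 k) (g k)) \<Longrightarrow> R Q1 k < R (\<lambda>i. c *\<^sub>R Q1 i) k" if "k \<in> ?I" for k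
  proof -
    \<comment> \<open>Signal and interference both scale by \<open>c\<close>, so the ratio condition
      holds with equality, and the signal grows strictly when it is positive.\<close>
    let ?a = "Re (quad_form (Q1 k) (g k))" and ?b = "\<Sum>i\<in>?I - {k}. Re (quad_form (Q1 i) (g k))"
    have scaled: "R (\<lambda>i. c *\<^sub>R Q1 i) k = mean_rate M (X k) (s k) (c * ?a) (c * ?b)"
      by (simp add: R_def quad_form_scaleR sum_distrib_left)
    have ab: "0 \<le> ?a" "0 \<le> ?b"
      using nn that by (auto intro!: sum_nonneg)
    show "R Q1 k \<le> R (\<lambda>i. c *\<^sub>R Q1 i) k"
      unfolding scaled unfolding R_def using that s X ab c(1)
      by (intro mean_rate_mono) (auto simp: mult_le_cancel_right1)
    show "R Q1 k < R (\<lambda>i. c *\<^sub>R Q1 i) k" if "0 < ?a"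
      unfolding scaled unfolding R_def using \<open>k \<in> ?I\<close> that s X ab c(1)
      by (intro mean_rate_strict_mono) auto
  qed
  have "feasible K P (\<lambda>i. c *\<^sub>R Q1 i)"
    using c psd1 by (auto simp: feasible_def trace_scaleR T_def intro!: psd_scaleR simp flip: sum_distrib_left)
  from best[OF this] have sum_le: "(\<Sum>k\<in>?I. R (\<lambda>i. c *\<^sub>R Q1 i) k) \<le> (\<Sum>k\<in>?I. R Q1 k)"
    using sum_mono[of ?I "R Q" "R Q1"] R_Q1 by simp
  \<comment> \<open>A single user with positive signal would make the scaled total strictly larger,
    contradicting \<open>sum_le\<close>.\<close>
  have no_signal: "Re (quad_form (Q1 k) (g k)) = 0" if "k \<in> ?I" for k
  proof (rule ccontr)
    assume "Re (quad_form (Q1 k) (g k)) \<noteq> 0"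
    then have "0 < Re (quad_form (Q1 k) (g k))"
      using nn(2)[OF that, of "g k"] by simp
    then have "(\<Sum>k\<in>?I. R Q1 k) < (\<Sum>k\<in>?I. R (\<lambda>i. c *\<^sub>R Q1 i) k)"
      using R_scale that by (intro sum_strict_mono_ex1 ballI bexI[of _ k]) simp_all
    with sum_le show False by simp
  qed
  then have "(\<Sum>k\<in>?I. R Q k) = 0"
    by (intro sum.neutral) (simp add: R_def flip: signal)
  moreover
  \<comment> \<open>Isotropic transmission to user 1 uses exactly the power \<open>P\<close> and
    gives a positive signal because \<open>g 1\<close> is nonzero.\<close>
  define Q2 where "Q2 k = (if k = 1 then mat (of_real (P / CARD('m))) else 0 :: complex^'m^'m)" for k :: nat
  have psd2: "psd (Q2 i)" for i
    using P psd_mat[where 'n='m, of "P / CARD('m)"] psd_mat[where 'n='m, of 0] by (simp add: Q2_def mat_0)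
  have "(\<Sum>k\<in>?I. Re (trace (Q2 k))) = (\<Sum>k\<in>?I. if k = 1 then P else 0)"
    by (intro sum.cong refl) (simp add: Q2_def trace_def mat_def)
  then have "feasible K P Q2"
    using psd2 \<open>1 \<le> K\<close> by (simp add: feasible_def)
  then have "(\<Sum>k\<in>?I. R Q2 k) \<le> (\<Sum>k\<in>?I. R Q k)"
    by (rule best)
  moreover have "0 < (\<Sum>k\<in>?I. R Q2 k)"
  proof (rule sum_pos2)
    have nn2: "0 \<le> Re (quad_form (Q2 i) x)" for i x
      using psd2 by (simp add: psd_def)
    have "Re (quad_form (Q2 1) (g 1)) = P / CARD('m) * (norm (g 1))\<^sup>2"
      by (simp add: Q2_def quad_form_mat flip: of_real_mult of_real_power of_real_divide)
    then have pos: "0 < Re (quad_form (Q2 1) (g 1))"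
      using P g by simp
    \<comment> \<open>The comparison point with signal and interference 0 has rate 0.\<close>
    have "mean_rate M (X 1) (s 1) 0 0 < R Q2 1"
      unfolding R_def using \<open>1 \<le> K\<close> s X pos nn2
      by (intro mean_rate_strict_mono sum_nonneg) auto
    then show "0 < R Q2 1" by simp
    show "0 \<le> R Q2 k" if "k \<in> ?I" for k
    proof -
      have "mean_rate M (X k) (s k) 0 0 \<le> R Q2 k"
        unfolding R_def using that s X nn2 by (intro mean_rate_mono sum_nonneg) auto
      then show ?thesis by simp
    qed
  qed (use \<open>1 \<le> K\<close> in auto)
  ultimately show False by simp
qed

section \<open>Application to planar arrays and Rician channels\<close>

text \<open>Every entry is a product of two exponentials, each divided by a nonzero number. This
  provides the nonzero \<open>g 1\<close> for the competing solution.\<close>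

lemma upa_response_nonzero: "upa_response lam dx dy ax ay \<noteq> 0"
proof -
  have "upa_response lam dx dy ax ay $ p \<noteq> 0" for p
    by (simp add: upa_response_def kron_def array_response_def)
  then show ?thesis
    by (metis zero_index)
qed

theorem theorem1:
  fixes W :: "'w measure"
    and K :: nat
    and P lam dx dy dx' dy' :: real
    and s \<kappa> \<beta> \<theta>x \<theta>y \<phi>x \<phi>y :: "nat \<Rightarrow> real"
    and g :: "nat \<Rightarrow> complex^('mx::{finite,linorder} \<times> 'my::{finite,linorder})"
    and d0 :: "nat \<Rightarrow> complex^('nx::{finite,linorder} \<times> 'ny::{finite,linorder})"
    and dt d :: "nat \<Rightarrow> 'w \<Rightarrow> complex^('nx \<times> 'ny)"
    and \<Sigma> :: "nat \<Rightarrow> complex^('nx \<times> 'ny)^('nx \<times> 'ny)"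
    and H :: "nat \<Rightarrow> 'w \<Rightarrow> complex^('mx \<times> 'my)^('nx \<times> 'ny)"
  assumes "prob_space W"
    and "K \<ge> 1" and "P > 0"
    and "lam > 0" and "dx > 0" and "dy > 0" and "dx' > 0" and "dy' > 0"
    and "\<And>k. k \<in> {1..K} \<Longrightarrow> s k > 0"
    and "\<And>k. k \<in> {1..K} \<Longrightarrow> \<kappa> k \<ge> 0"
    and "\<And>k. k \<in> {1..K} \<Longrightarrow> \<beta> k > 0"
    and "\<And>k. k \<in> {1..K} \<Longrightarrow> g k = upa_response lam dx dy (\<theta>x k) (\<theta>y k)"
    and "\<And>k. k \<in> {1..K} \<Longrightarrow> d0 k = upa_response lam dx' dy' (\<phi>x k) (\<phi>y k)"
    and "\<And>k. k \<in> {1..K} \<Longrightarrow> has_CN_distribution W (dt k) (\<Sigma> k)"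
    and "\<And>k. k \<in> {1..K} \<Longrightarrow> trace (\<Sigma> k) = 1"
    and "\<And>k \<omega>. k \<in> {1..K} \<Longrightarrow> d k \<omega> = rician (\<kappa> k) (\<beta> k) (d0 k) (dt k \<omega>)"
    and "\<And>k \<omega>. k \<in> {1..K} \<Longrightarrow> H k \<omega> = outer (d k \<omega>) (g k)"
  shows "(\<forall>Q. (\<forall>k\<in>{1..K}. psd (Q k)) \<longrightarrow>
            (\<forall>k\<in>{1..K}. ergodic_rate W K s H Q k =
               (\<integral>\<omega>. ln (1 + Re (quad_form (Q k) (g k)) * (norm (d k \<omega>))\<^sup>2
                   / ((\<Sum>i\<in>{1..K} - {k}. Re (quad_form (Q i) (g k)) * (norm (d k \<omega>))\<^sup>2) + s k)) \<partial>W)))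
       \<and> (\<forall>Q. optimal_solution W K P s H Q \<longrightarrow> (\<forall>k\<in>{1..K}. rank (Q k) \<le> 1))"
proof -
  interpret prob_space W by fact
  let ?X = "\<lambda>k \<omega>. (norm (d k \<omega>))\<^sup>2"
  have int: "integrable W (?X k)" if "k \<in> {1..K}" for k
  proof -
    have "gaussian_vector W (dt k)"
      using assms(14)[OF that] unfolding has_CN_distribution_def by blast
    then show ?thesis
      using assms(16)[OF that] by (simp add: rician_norm_square_integrable)
  qed
  have not_zero: "\<not> (AE \<omega> in W. ?X k \<omega> = 0)" if "k \<in> {1..K}" for k
    using rician_not_AE_zero[of "dt k" "\<Sigma> k" "\<kappa> k" "\<beta> k" "d0 k"] assms(10,11,14,15,16) that
    by simp
  have rate: "ergodic_rate W K s H Q k = mean_rate W (?X k) (s k) (Re (quad_form (Q k) (g k)))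
      (\<Sum>i\<in>{1..K} - {k}. Re (quad_form (Q i) (g k)))"
    if "\<And>i. i \<in> {1..K} \<Longrightarrow> psd (Q i)" "k \<in> {1..K}" for Q k
    using that assms(9,17) int by (intro ergodic_rate_rank_one) auto
  have "rank (Q k) \<le> 1" if "optimal_solution W K P s H Q" "k \<in> {1..K}" for Q k
  proof -
    have "g 1 \<noteq> 0"
      using assms(2,12) by (simp add: upa_response_nonzero)
    \<comment> \<open>The open slot is the nonnegativity of the squared norms.\<close>
    from optimal_solution_eq_beam[OF assms(3,2) this assms(9) int _ not_zero rate that]
    have "beam (Q k) (g k) = Q k"
      by simp
    then show ?thesis
      by (metis rank_beam)
  qed
  then show ?thesis
    \<comment> \<open>The stated formula keeps the gain inside the interference sum, whereas
      \<open>mean_rate\<close> has it factored out.\<close>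
    using rate by (simp add: mean_rate_def sum_distrib_right)
qed

end
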